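(* Let $\mathcal{X}$ be a category and $\mathcal{M}$ a class of morphisms of $\mathcal{X}$ such that $\mathcal{X}$ has quasi right $\mathcal{M}$-factorizations. Suppose that every morphism in $\mathcal{M}$ is strongly quasi mono and that $\mathcal{M}$ is a codomain. If $\mathbf{C}$ is a closure operator on $\mathcal{X}$ with respect to $\mathcal{M}$ such that $(\mathcal{E}^{QC},\mathcal{M}^{QC})$ is a quasi factorization structure in $\mathcal{X}$, then $\mathbf{C}$ is quasi weakly hereditary and quasi idempotent.
   Context: For a class $\mathcal{M}$ of morphisms and an object $X$, $\mathcal{M}/X$ is the class of all morphisms in $\mathcal{M}$ with codomain $X$. For a morphism $f$, $\langle f\rangle=\{fh : h\in\mathcal{X},\ fh\text{ defined}\}$ and $\rangle f\langle=\{hf : h\in\mathcal{X},\ hf\text{ defined}\}$. For morphisms $f,g$ with the same codomain, $f\leqslant g$ means $\langle f\rangle\subseteq\langle g\rangle$ (equivalently $f=gj$ for some $j$), and $f\sim g$ means $f\leqslant g$ and $g\leqslant f$. A morphism $f$ is strongly quasi mono if for all morphisms $a,b$, $fa=fb$ implies $\langle a\rangle=\langle b\rangle$ and $\rangle a\langle=\rangle b\langle$. A nonempty class $\mathcal{M}$ of morphisms is called a codomain if $m\in\mathcal{M}$ and $\rangle m\langle\subseteq\rangle a\langle$ imply $a\in\mathcal{M}$. $\mathcal{X}$ has quasi right $\mathcal{M}$-factorizations if for every morphism $f:Y\to X$ there is $m_f\in\mathcal{M}/X$ (called a quasi right part of $f$) such that (a) $f=m_fg$ for some $g$; (b) if $m\in\mathcal{M}/X$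 and $f=mg$ for some $g$, then $m_f=mh$ for some $h$. A quasi right part is determined up to $\sim$. A (general) closure operator $\mathbf{C}=(\mathbf{c}_X)_{X\in\mathcal{X}}$ on $\mathcal{X}$ with respect to $\mathcal{M}$ (where $\mathcal{X}$ has quasi right $\mathcal{M}$-factorizations) is a family of maps $\mathbf{c}_X:\mathcal{M}/X\to\mathcal{M}/X$ such that: (a) $m\leqslant\mathbf{c}_X(m)$ for all $m\in\mathcal{M}/X$; (b) if $m\leqslant m'$ in $\mathcal{M}/X$ then $\mathbf{c}_X(m)\leqslant\mathbf{c}_X(m')$; (c) for every $f:X\to Y$ and $m\in\mathcal{M}/X$, $m_{f\mathbf{c}_X(m)}\leqslant\mathbf{c}_Y(m_{fm})$. For $m:M\to X$ in $\mathcal{M}$, write $\mathbf{c}_X(m):\mathbf{c}_X(M)\to X$. $m\in\mathcal{M}/X$ is quasi $\mathbf{C}$-closed if $\mathbf{c}_X(m)\sim m$, and quasi $\mathbf{C}$-dense if $\mathbf{c}_X(m)\sim 1_X$. An arbitrary morphism $f$ is quasi $\mathbf{C}$-dense if $m_f$ is quasi $\mathbf{C}$-dense. $\mathcal{M}^{QC}$ is the class of quasi $\mathbf{C}$-closed members of $\mathcal{M}$ and $\mathcal{E}^{QC}$ the class of all quasi $\mathbf{C}$-dense morphisms of $\mathcal{X}$. $\mathbf{C}$ is quasi idempotent if $\mathbf{c}_X(\mathbf{c}_X(m))\sim\mathbf{c}_X(m)$ for all $X$ and $m\in\mathcal{M}/X$; quasi weakly hereditary if for every $m:M\to X$ in $\mathcal{M}$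 there is a quasi $\mathbf{C}$-dense morphism $j_m:M\to\mathbf{c}_X(M)$ with $\mathbf{c}_X(m)j_m=m$. For $e:E\to X$ and $m:M\to X$, write $e\downarrow m$ if: whenever $e=mu$ for some $u:E\to M$, there is $w:X\to M$ with $mw\sim 1_X$. For $e:M\to E$ and $m:M\to X$, write $e\uparrow m$ if: for every $v:E\to X$ with $ve=m$ there is $w:E\to M$ with $mw\sim v$. For a class $\mathcal{H}$ of morphisms, ${}^{\downarrow}\mathcal{H}$ is the class of all morphisms $e$ with $e\downarrow h$ for all $h\in\mathcal{H}$ with the same codomain as $e$, and $\mathcal{H}^{\uparrow}$ is the class of all morphisms $m$ with $h\uparrow m$ for all $h\in\mathcal{H}$ with the same domain as $m$. A quasi factorization structure in $\mathcal{X}$ is a pair $(\mathcal{A},\mathcal{B})$ of classes of morphisms such that (a) every morphism $f$ factors as $f=be$ with $e\in\mathcal{A}$, $b\in\mathcal{B}$; (b) $\mathcal{A}\subseteq{}^{\downarrow}\mathcal{B}$ and $\mathcal{B}\subseteq\mathcal{A}^{\uparrow}$. *)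

theory Defs
  imports Main
begin

text \<open>
  A category has a set of objects and a set of morphisms inside two arbitrary types.
  Composition is a total function that is constrained only on composable pairs;
  \<open>f \<cdot>\<^bsub>\<X>\<^esub> g\<close> is ``\<open>f\<close> after \<open>g\<close>'', so it is defined when \<open>Dom \<X> f = Cod \<X> g\<close>.
\<close>

record ('o, 'm) cat =
  Ob :: "'o set"
  Mor :: "'m set"
  Dom :: "'m \<Rightarrow> 'o"
  Cod :: "'m \<Rightarrow> 'o"
  Ident :: "'o \<Rightarrow> 'm"
  Comp :: "'m \<Rightarrow> 'm \<Rightarrow> 'm" (infixl "\<cdot>\<index>" 70)

locale category =
  fixes \<X> :: "('o, 'm) cat" (structure)
  assumes dom_closed: "f \<in> Mor \<X> \<Longrightarrow> Dom \<X> f \<in> Ob \<X>"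
    and cod_closed: "f \<in> Mor \<X> \<Longrightarrow> Cod \<X> f \<in> Ob \<X>"
    and ident_closed: "A \<in> Ob \<X> \<Longrightarrow> Ident \<X> A \<in> Mor \<X>"
    and dom_ident: "A \<in> Ob \<X> \<Longrightarrow> Dom \<X> (Ident \<X> A) = A"
    and cod_ident: "A \<in> Ob \<X> \<Longrightarrow> Cod \<X> (Ident \<X> A) = A"
    and comp_closed: "\<lbrakk>f \<in> Mor \<X>; g \<in> Mor \<X>; Dom \<X> f = Cod \<X> g\<rbrakk> \<Longrightarrow> f \<cdot> g \<in> Mor \<X>"
    and dom_comp: "\<lbrakk>f \<in> Mor \<X>; g \<in> Mor \<X>; Dom \<X> f = Cod \<X> g\<rbrakk> \<Longrightarrow> Dom \<X> (f \<cdot> g) = Dom \<X> g"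
    and cod_comp: "\<lbrakk>f \<in> Mor \<X>; g \<in> Mor \<X>; Dom \<X> f = Cod \<X> g\<rbrakk> \<Longrightarrow> Cod \<X> (f \<cdot> g) = Cod \<X> f"
    and comp_assoc: "\<lbrakk>f \<in> Mor \<X>; g \<in> Mor \<X>; h \<in> Mor \<X>; Dom \<X> f = Cod \<X> g; Dom \<X> g = Cod \<X> h\<rbrakk>
          \<Longrightarrow> (f \<cdot> g) \<cdot> h = f \<cdot> (g \<cdot> h)"
    and comp_ident_right: "f \<in> Mor \<X> \<Longrightarrow> f \<cdot> Ident \<X> (Dom \<X> f) = f"
    and comp_ident_left: "f \<in> Mor \<X> \<Longrightarrow> Ident \<X> (Cod \<X> f) \<cdot> f = f"

definition hom_set :: "('o, 'm) cat \<Rightarrow> 'o \<Rightarrow> 'o \<Rightarrow> 'm set" where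
  "hom_set \<X> A B = {f \<in> Mor \<X>. Dom \<X> f = A \<and> Cod \<X> f = B}"

definition over :: "('o, 'm) cat \<Rightarrow> 'm set \<Rightarrow> 'o \<Rightarrow> 'm set" where
  "over \<X> \<M> A = {m \<in> \<M>. Cod \<X> m = A}"

text \<open>\<open>\<langle>f\<rangle>\<close> is the principal sieve, \<open>\<rangle>f\<langle>\<close> the principal cosieve of \<open>f\<close>.\<close>

definition sieve :: "('o, 'm) cat \<Rightarrow> 'm \<Rightarrow> 'm set" where
  "sieve \<X> f = {f \<cdot>\<^bsub>\<X>\<^esub> h | h. h \<in> Mor \<X> \<and> Dom \<X> f = Cod \<X> h}"

definition cosieve :: "('o, 'm) cat \<Rightarrow> 'm \<Rightarrow> 'm set" where
  "cosieve \<X> f = {h \<cdot>\<^bsub>\<X>\<^esub> f | h. h \<in> Mor \<X> \<and> Dom \<X> h = Cod \<X> f}"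

definition mor_le :: "('o, 'm) cat \<Rightarrow> 'm \<Rightarrow> 'm \<Rightarrow> bool" where
  "mor_le \<X> f g \<longleftrightarrow> Cod \<X> f = Cod \<X> g \<and> sieve \<X> f \<subseteq> sieve \<X> g"

definition mor_sim :: "('o, 'm) cat \<Rightarrow> 'm \<Rightarrow> 'm \<Rightarrow> bool" where
  "mor_sim \<X> f g \<longleftrightarrow> mor_le \<X> f g \<and> mor_le \<X> g f"

definition strongly_quasi_mono :: "('o, 'm) cat \<Rightarrow> 'm \<Rightarrow> bool" where
  "strongly_quasi_mono \<X> f \<longleftrightarrow> f \<in> Mor \<X> \<and>
     (\<forall>a\<in>Mor \<X>. \<forall>b\<in>Mor \<X>. Cod \<X> a = Dom \<X> f \<longrightarrow> Cod \<X> b = Dom \<X> f \<longrightarrow>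
        f \<cdot>\<^bsub>\<X>\<^esub> a = f \<cdot>\<^bsub>\<X>\<^esub> b \<longrightarrow> sieve \<X> a = sieve \<X> b \<and> cosieve \<X> a = cosieve \<X> b)"

definition is_codomain :: "('o, 'm) cat \<Rightarrow> 'm set \<Rightarrow> bool" where
  "is_codomain \<X> \<M> \<longleftrightarrow> \<M> \<subseteq> Mor \<X> \<and> \<M> \<noteq> {} \<and>
     (\<forall>m\<in>\<M>. \<forall>a\<in>Mor \<X>. cosieve \<X> m \<subseteq> cosieve \<X> a \<longrightarrow> a \<in> \<M>)"

definition quasi_right_part :: "('o, 'm) cat \<Rightarrow> 'm set \<Rightarrow> 'm \<Rightarrow> 'm \<Rightarrow> bool" where
  "quasi_right_part \<X> \<M> f n \<longleftrightarrow> n \<in> over \<X> \<M> (Cod \<X> f) \<and>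
     (\<exists>g \<in> hom_set \<X> (Dom \<X> f) (Dom \<X> n). f = n \<cdot>\<^bsub>\<X>\<^esub> g) \<and>
     (\<forall>m \<in> over \<X> \<M> (Cod \<X> f).
        (\<exists>g \<in> hom_set \<X> (Dom \<X> f) (Dom \<X> m). f = m \<cdot>\<^bsub>\<X>\<^esub> g) \<longrightarrow>
        (\<exists>h \<in> hom_set \<X> (Dom \<X> n) (Dom \<X> m). n = m \<cdot>\<^bsub>\<X>\<^esub> h))"

definition has_quasi_right_factorizations :: "('o, 'm) cat \<Rightarrow> 'm set \<Rightarrow> bool" where
  "has_quasi_right_factorizations \<X> \<M> \<longleftrightarrow> (\<forall>f\<in>Mor \<X>. \<exists>n. quasi_right_part \<X> \<M> f n)"

text \<open>
  Quasi right parts are determined only up to \<open>\<sim>\<close>, so no particular \<open>m\<^sub>f\<close> is chosen: the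
  continuity condition ranges over all quasi right parts \<open>p\<close> of \<open>f \<cdot> c\<^sub>A(m)\<close> and \<open>q\<close> of \<open>f \<cdot> m\<close>.
  By monotonicity this agrees with the condition for any single choice; the corresponding
  fact for density is \<open>quasi_dense_iff_all\<close> below.
\<close>

definition closure_operator ::
  "('o, 'm) cat \<Rightarrow> 'm set \<Rightarrow> ('o \<Rightarrow> 'm \<Rightarrow> 'm) \<Rightarrow> bool" where
  "closure_operator \<X> \<M> c \<longleftrightarrow>
     (\<forall>A\<in>Ob \<X>. \<forall>m\<in>over \<X> \<M> A. c A m \<in> over \<X> \<M> A) \<and>
     (\<forall>A\<in>Ob \<X>. \<forall>m\<in>over \<X> \<M> A. mor_le \<X> m (c A m)) \<and>
     (\<forall>A\<in>Ob \<X>. \<forall>m\<in>over \<X> \<M> A. \<forall>m'\<in>over \<X> \<M> A.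
        mor_le \<X> m m' \<longrightarrow> mor_le \<X> (c A m) (c A m')) \<and>
     (\<forall>A\<in>Ob \<X>. \<forall>B\<in>Ob \<X>. \<forall>f\<in>hom_set \<X> A B. \<forall>m\<in>over \<X> \<M> A. \<forall>p q.
        quasi_right_part \<X> \<M> (f \<cdot>\<^bsub>\<X>\<^esub> c A m) p \<longrightarrow> quasi_right_part \<X> \<M> (f \<cdot>\<^bsub>\<X>\<^esub> m) q \<longrightarrow>
        mor_le \<X> p (c B q))"

definition quasi_closed ::
  "('o, 'm) cat \<Rightarrow> 'm set \<Rightarrow> ('o \<Rightarrow> 'm \<Rightarrow> 'm) \<Rightarrow> 'm \<Rightarrow> bool" where
  "quasi_closed \<X> \<M> c m \<longleftrightarrow> m \<in> \<M> \<and> mor_sim \<X> (c (Cod \<X> m) m) m"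

definition quasi_dense_in ::
  "('o, 'm) cat \<Rightarrow> 'm set \<Rightarrow> ('o \<Rightarrow> 'm \<Rightarrow> 'm) \<Rightarrow> 'm \<Rightarrow> bool" where
  "quasi_dense_in \<X> \<M> c m \<longleftrightarrow> m \<in> \<M> \<and> mor_sim \<X> (c (Cod \<X> m) m) (Ident \<X> (Cod \<X> m))"

definition quasi_dense ::
  "('o, 'm) cat \<Rightarrow> 'm set \<Rightarrow> ('o \<Rightarrow> 'm \<Rightarrow> 'm) \<Rightarrow> 'm \<Rightarrow> bool" where
  "quasi_dense \<X> \<M> c f \<longleftrightarrow> f \<in> Mor \<X> \<and>
     (\<exists>n. quasi_right_part \<X> \<M> f n \<and> quasi_dense_in \<X> \<M> c n)"

definition closed_class ::
  "('o, 'm) cat \<Rightarrow> 'm set \<Rightarrow> ('o \<Rightarrow> 'm \<Rightarrow> 'm) \<Rightarrow> 'm set" where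
  "closed_class \<X> \<M> c = {m \<in> \<M>. quasi_closed \<X> \<M> c m}"

definition dense_class ::
  "('o, 'm) cat \<Rightarrow> 'm set \<Rightarrow> ('o \<Rightarrow> 'm \<Rightarrow> 'm) \<Rightarrow> 'm set" where
  "dense_class \<X> \<M> c = {e \<in> Mor \<X>. quasi_dense \<X> \<M> c e}"

definition quasi_idempotent ::
  "('o, 'm) cat \<Rightarrow> 'm set \<Rightarrow> ('o \<Rightarrow> 'm \<Rightarrow> 'm) \<Rightarrow> bool" where
  "quasi_idempotent \<X> \<M> c \<longleftrightarrow>
     (\<forall>A\<in>Ob \<X>. \<forall>m\<in>over \<X> \<M> A. mor_sim \<X> (c A (c A m)) (c A m))"

definition quasi_weakly_hereditary ::
  "('o, 'm) cat \<Rightarrow> 'm set \<Rightarrow> ('o \<Rightarrow> 'm \<Rightarrow> 'm) \<Rightarrow> bool" where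
  "quasi_weakly_hereditary \<X> \<M> c \<longleftrightarrow>
     (\<forall>A\<in>Ob \<X>. \<forall>m\<in>over \<X> \<M> A. \<exists>j \<in> hom_set \<X> (Dom \<X> m) (Dom \<X> (c A m)).
        quasi_dense \<X> \<M> c j \<and> c A m \<cdot>\<^bsub>\<X>\<^esub> j = m)"

text \<open>\<open>down_orth \<X> e m\<close> is \<open>e \<down> m\<close> (common codomain); \<open>up_orth \<X> e m\<close> is \<open>e \<up> m\<close> (common domain).\<close>

definition down_orth :: "('o, 'm) cat \<Rightarrow> 'm \<Rightarrow> 'm \<Rightarrow> bool" where
  "down_orth \<X> e m \<longleftrightarrow>
     ((\<exists>u \<in> hom_set \<X> (Dom \<X> e) (Dom \<X> m). e = m \<cdot>\<^bsub>\<X>\<^esub> u) \<longrightarrow>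
      (\<exists>w \<in> hom_set \<X> (Cod \<X> m) (Dom \<X> m). mor_sim \<X> (m \<cdot>\<^bsub>\<X>\<^esub> w) (Ident \<X> (Cod \<X> m))))"

definition up_orth :: "('o, 'm) cat \<Rightarrow> 'm \<Rightarrow> 'm \<Rightarrow> bool" where
  "up_orth \<X> e m \<longleftrightarrow>
     (\<forall>v \<in> hom_set \<X> (Cod \<X> e) (Cod \<X> m). v \<cdot>\<^bsub>\<X>\<^esub> e = m \<longrightarrow>
        (\<exists>w \<in> hom_set \<X> (Cod \<X> e) (Dom \<X> m). mor_sim \<X> (m \<cdot>\<^bsub>\<X>\<^esub> w) v))"

definition down_class :: "('o, 'm) cat \<Rightarrow> 'm set \<Rightarrow> 'm set" where
  "down_class \<X> \<H> = {e \<in> Mor \<X>. \<forall>h\<in>\<H>. Cod \<X> h = Cod \<X> e \<longrightarrow> down_orth \<X> e h}"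

definition up_class :: "('o, 'm) cat \<Rightarrow> 'm set \<Rightarrow> 'm set" where
  "up_class \<X> \<H> = {m \<in> Mor \<X>. \<forall>h\<in>\<H>. Dom \<X> h = Dom \<X> m \<longrightarrow> up_orth \<X> h m}"

definition quasi_factorization_structure ::
  "('o, 'm) cat \<Rightarrow> 'm set \<Rightarrow> 'm set \<Rightarrow> bool" where
  "quasi_factorization_structure \<X> \<A> \<B> \<longleftrightarrow> \<A> \<subseteq> Mor \<X> \<and> \<B> \<subseteq> Mor \<X> \<and>
     (\<forall>f\<in>Mor \<X>. \<exists>e\<in>\<A>. \<exists>b\<in>\<B>. Dom \<X> b = Cod \<X> e \<and> f = b \<cdot>\<^bsub>\<X>\<^esub> e) \<and>
     \<A> \<subseteq> down_class \<X> \<B> \<and> \<B> \<subseteq> up_class \<X> \<A>"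

lemma mor_sim_trans: "mor_sim \<X> f g \<Longrightarrow> mor_sim \<X> g h \<Longrightarrow> mor_sim \<X> f h"
  unfolding mor_sim_def mor_le_def by (metis subset_trans)

lemma (in category) mor_le_iff:
  assumes f: "f \<in> Mor \<X>" and g: "g \<in> Mor \<X>"
  shows "mor_le \<X> f g \<longleftrightarrow> (\<exists>j \<in> hom_set \<X> (Dom \<X> f) (Dom \<X> g). f = g \<cdot> j)"
proof
  assume "mor_le \<X> f g"
  moreover have "f \<in> sieve \<X> f"
    using comp_ident_right[OF f, symmetric] ident_closed[OF dom_closed[OF f]]
      cod_ident[OF dom_closed[OF f], symmetric] unfolding sieve_def by blast
  ultimately have "f \<in> sieve \<X> g" by (auto simp: mor_le_def)
  then show "\<exists>j \<in> hom_set \<X> (Dom \<X> f) (Dom \<X> g). f = g \<cdot> j"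
    using g by (auto simp: sieve_def hom_set_def dom_comp)
next
  assume "\<exists>j \<in> hom_set \<X> (Dom \<X> f) (Dom \<X> g). f = g \<cdot> j"
  then obtain j where j: "j \<in> Mor \<X>" "Dom \<X> j = Dom \<X> f" "Cod \<X> j = Dom \<X> g" "f = g \<cdot> j"
    by (auto simp: hom_set_def)
  have "(g \<cdot> j) \<cdot> h = g \<cdot> (j \<cdot> h) \<and> j \<cdot> h \<in> Mor \<X> \<and> Dom \<X> g = Cod \<X> (j \<cdot> h)"
    if "h \<in> Mor \<X>" "Dom \<X> j = Cod \<X> h" for h
    using that g j(1-3) by (simp add: comp_assoc comp_closed cod_comp)
  then have "sieve \<X> f \<subseteq> sieve \<X> g" using j(2,4) unfolding sieve_def by auto
  then show "mor_le \<X> f g" using g j by (simp add: mor_le_def cod_comp)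
qed

lemma (in category) quasi_right_part_unique:
  assumes M: "\<M> \<subseteq> Mor \<X>" and "quasi_right_part \<X> \<M> f n" "quasi_right_part \<X> \<M> f n'"
  shows "mor_sim \<X> n n'"
proof -
  have "mor_le \<X> a b" if "quasi_right_part \<X> \<M> f a" "quasi_right_part \<X> \<M> f b" for a b
  proof -
    have "a \<in> Mor \<X>" "b \<in> Mor \<X>" using that M by (auto simp: quasi_right_part_def over_def)
    then show ?thesis using that by (simp add: quasi_right_part_def mor_le_iff)
  qed
  then show ?thesis using assms by (simp add: mor_sim_def)
qed

lemma (in category) quasi_dense_iff_all:
  assumes M: "\<M> \<subseteq> Mor \<X>" and fact: "has_quasi_right_factorizations \<X> \<M>"
    and c: "closure_operator \<X> \<M> c" and f: "f \<in> Mor \<X>"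
  shows "quasi_dense \<X> \<M> c f \<longleftrightarrow> (\<forall>n. quasi_right_part \<X> \<M> f n \<longrightarrow> quasi_dense_in \<X> \<M> c n)"
proof -
  have "quasi_dense_in \<X> \<M> c n'"
    if n: "quasi_right_part \<X> \<M> f n" "quasi_right_part \<X> \<M> f n'" "quasi_dense_in \<X> \<M> c n" for n n'
  proof -
    have nn: "mor_sim \<X> n n'" using quasi_right_part_unique[OF M n(1,2)] .
    have A: "Cod \<X> f \<in> Ob \<X>" using f cod_closed by simp
    have o: "n \<in> over \<X> \<M> (Cod \<X> f)" "n' \<in> over \<X> \<M> (Cod \<X> f)"
      using n by (auto simp: quasi_right_part_def)
    have "mor_sim \<X> (c (Cod \<X> f) n') (c (Cod \<X> f) n)"
      using c A o nn unfolding closure_operator_def mor_sim_def by blast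
    moreover have "Cod \<X> n = Cod \<X> f" "Cod \<X> n' = Cod \<X> f" "n' \<in> \<M>"
      using o by (simp_all add: over_def)
    moreover from this have "mor_sim \<X> (c (Cod \<X> f) n) (Ident \<X> (Cod \<X> f))"
      using n(3) by (simp add: quasi_dense_in_def)
    ultimately show ?thesis
      unfolding quasi_dense_in_def using mor_sim_trans by metis
  qed
  moreover obtain n where "quasi_right_part \<X> \<M> f n"
    using fact f unfolding has_quasi_right_factorizations_def by blast
  ultimately show ?thesis using f unfolding quasi_dense_def by blast
qed

end

theory Submission
  imports Defs
begin

text \<open>
  Factor a member \<open>m\<close> of \<open>\<M>\<close> as \<open>m = b \<cdot> e\<close> with \<open>e\<close> quasi dense and \<open>b\<close> quasi closed. The
  whole proof rests on the fact that such a \<open>b\<close> is equivalent to the closure of \<open>m\<close>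
  (\<open>closed_part_sim_closure\<close>). On the one hand \<open>m \<le> b\<close> and \<open>b\<close> is closed, so
  \<open>c(m) \<le> b\<close>. On the other hand \<open>\<M>\<close> is a codomain, so \<open>e\<close> is itself in \<open>\<M>\<close> and its density
  says \<open>1 \<le> c(e)\<close>; continuity along \<open>b\<close> turns this into \<open>b \<le> b \<cdot> c(e) \<le> c(b \<cdot> e) = c(m)\<close>.
  Quasi idempotency is then immediate, because \<open>b\<close> is closed.

  For weak heredity write \<open>b = c(m) \<cdot> q\<close> and \<open>c(m) = b \<cdot> p\<close>. Then \<open>j = q \<cdot> e\<close> satisfies
  \<open>c(m) \<cdot> j = m\<close>, and only its density is in question. Since \<open>c(m) \<cdot> (q \<cdot> p) = c(m)\<close>, strong
  quasi monicity of \<open>c(m)\<close> makes \<open>q\<close> a split epimorphism, and a split epimorphism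
  after a dense member of \<open>\<M>\<close> is dense as soon as the composite lies in \<open>\<M>\<close>, once more by
  continuity (\<open>split_epi_comp_dense\<close>).
\<close>

context category
begin

section \<open>The preorder on morphisms with a common codomain\<close>

lemma mor_le_refl: "mor_le \<X> f f"
  by (simp add: mor_le_def)

lemma mor_le_trans: "mor_le \<X> f g \<Longrightarrow> mor_le \<X> g h \<Longrightarrow> mor_le \<X> f h"
  unfolding mor_le_def by auto

lemma mor_le_Ident:
  assumes "f \<in> Mor \<X>"
  shows "mor_le \<X> f (Ident \<X> (Cod \<X> f))"
proof -
  have "Cod \<X> f \<in> Ob \<X>" using assms by (rule cod_closed)
  then show ?thesis
    using assms mor_le_iff[OF assms ident_closed]
    by (auto simp: hom_set_def dom_ident comp_ident_left intro!: bexI[of _ f])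
qed

lemma comp_mor_le:
  assumes "f \<in> Mor \<X>" "h \<in> Mor \<X>" "Dom \<X> f = Cod \<X> h"
  shows "mor_le \<X> (f \<cdot> h) f"
proof -
  have "f \<cdot> h \<in> Mor \<X>" using assms by (rule comp_closed)
  then show ?thesis using assms by (auto simp: mor_le_iff hom_set_def dom_comp)
qed

lemma mor_le_postcompose:
  assumes "f \<in> Mor \<X>" "g \<in> Mor \<X>" "h \<in> Mor \<X>" "Dom \<X> h = Cod \<X> g"
    and "mor_le \<X> f g"
  shows "mor_le \<X> (h \<cdot> f) (h \<cdot> g)"
proof -
  obtain j where j: "j \<in> Mor \<X>" "Cod \<X> j = Dom \<X> g" "f = g \<cdot> j"
    using assms by (auto simp: mor_le_iff hom_set_def)
  have "h \<cdot> f = (h \<cdot> g) \<cdot> j" using assms j by (simp add: comp_assoc)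
  then show ?thesis using assms j by (simp add: comp_mor_le comp_closed dom_comp)
qed

section \<open>Codomains and strongly quasi monomorphisms\<close>

lemma codomain_right_factor:
  assumes "is_codomain \<X> \<M>" and "b \<in> Mor \<X>" "e \<in> Mor \<X>" "Dom \<X> b = Cod \<X> e"
    and "b \<cdot> e \<in> \<M>"
  shows "e \<in> \<M>"
proof -
  have "h \<cdot> (b \<cdot> e) = (h \<cdot> b) \<cdot> e \<and> h \<cdot> b \<in> Mor \<X> \<and> Dom \<X> (h \<cdot> b) = Cod \<X> e"
    if "h \<in> Mor \<X>" "Dom \<X> h = Cod \<X> (b \<cdot> e)" for h
    using that assms by (simp add: comp_assoc comp_closed dom_comp cod_comp)
  then have "cosieve \<X> (b \<cdot> e) \<subseteq> cosieve \<X> e" unfolding cosieve_def by blast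
  then show ?thesis using assms unfolding is_codomain_def by blast
qed

text \<open>Compare \<open>f \<cdot> k\<close> with \<open>f \<cdot> 1\<close>: the sieve of \<open>k\<close> has to contain the identity.\<close>

lemma strongly_quasi_mono_stabilizer_split:
  assumes f: "strongly_quasi_mono \<X> f" and k: "k \<in> hom_set \<X> (Dom \<X> f) (Dom \<X> f)"
    and fk: "f \<cdot> k = f"
  shows "\<exists>s \<in> hom_set \<X> (Dom \<X> f) (Dom \<X> f). k \<cdot> s = Ident \<X> (Dom \<X> f)"
proof -
  let ?i = "Ident \<X> (Dom \<X> f)"
  have fM: "f \<in> Mor \<X>" using f by (simp add: strongly_quasi_mono_def)
  then have D: "Dom \<X> f \<in> Ob \<X>" by (rule dom_closed)
  have "sieve \<X> k = sieve \<X> ?i"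
    using f k fk D fM unfolding strongly_quasi_mono_def hom_set_def
    by (simp add: ident_closed cod_ident comp_ident_right)
  then have "mor_le \<X> ?i k"
    using k D by (simp add: mor_le_def hom_set_def cod_ident)
  then show ?thesis
    using k D by (auto simp: mor_le_iff hom_set_def ident_closed dom_ident)
qed

section \<open>Closure and density without a choice of quasi right parts\<close>

lemma quasi_right_part_upper:
  assumes "\<M> \<subseteq> Mor \<X>" "f \<in> Mor \<X>" "quasi_right_part \<X> \<M> f n"
  shows "mor_le \<X> f n"
proof -
  have "n \<in> Mor \<X>" using assms by (auto simp: quasi_right_part_def over_def)
  then show ?thesis using assms by (simp add: mor_le_iff quasi_right_part_def)
qed

lemma quasi_right_part_least:
  assumes "\<M> \<subseteq> Mor \<X>" "f \<in> Mor \<X>" "quasi_right_part \<X> \<M> f n" "m \<in> \<M>" "mor_le \<X> f m"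
  shows "mor_le \<X> n m"
proof -
  have "n \<in> Mor \<X>" "m \<in> Mor \<X>" using assms by (auto simp: quasi_right_part_def over_def)
  moreover have "m \<in> over \<X> \<M> (Cod \<X> f)" using assms by (simp add: over_def mor_le_def)
  ultimately show ?thesis using assms by (simp add: mor_le_iff quasi_right_part_def)
qed

text \<open>
  Continuity, freed from quasi right parts: since \<open>m\<^bsub>f \<cdot> m\<^esub>\<close> is the least member of \<open>\<M>\<close>
  above \<open>f \<cdot> m\<close>, every \<open>n\<close> in \<open>\<M>\<close> above \<open>f \<cdot> m\<close> satisfies
  \<open>f \<cdot> c(m) \<le> m\<^bsub>f \<cdot> c(m)\<^esub> \<le> c(m\<^bsub>f \<cdot> m\<^esub>) \<le> c(n)\<close>.
\<close>

lemma closure_continuous: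
  assumes M: "\<M> \<subseteq> Mor \<X>" and fact: "has_quasi_right_factorizations \<X> \<M>"
    and c: "closure_operator \<X> \<M> c"
    and f: "f \<in> Mor \<X>" and m: "m \<in> \<M>" "Cod \<X> m = Dom \<X> f"
    and n: "n \<in> \<M>" and le: "mor_le \<X> (f \<cdot> m) n"
  shows "mor_le \<X> (f \<cdot> c (Dom \<X> f) m) (c (Cod \<X> f) n)"
proof -
  let ?A = "Dom \<X> f" and ?B = "Cod \<X> f"
  have A: "?A \<in> Ob \<X>" and B: "?B \<in> Ob \<X>" using f by (simp_all add: dom_closed cod_closed)
  have mA: "m \<in> over \<X> \<M> ?A" using m by (simp add: over_def)
  then have cm: "c ?A m \<in> \<M>" "Cod \<X> (c ?A m) = ?A"
    using c A unfolding closure_operator_def over_def by auto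
  have mM: "m \<in> Mor \<X>" and cmM: "c ?A m \<in> Mor \<X>" using m cm M by auto
  have fm: "f \<cdot> m \<in> Mor \<X>" "Cod \<X> (f \<cdot> m) = ?B"
    using f mM m by (simp_all add: comp_closed cod_comp)
  have fcm: "f \<cdot> c ?A m \<in> Mor \<X>" using f cmM cm by (simp add: comp_closed)
  obtain p where p: "quasi_right_part \<X> \<M> (f \<cdot> c ?A m) p"
    using fact fcm unfolding has_quasi_right_factorizations_def by blast
  obtain q where q: "quasi_right_part \<X> \<M> (f \<cdot> m) q"
    using fact fm unfolding has_quasi_right_factorizations_def by blast
  have "mor_le \<X> (f \<cdot> c ?A m) p" using quasi_right_part_upper[OF M fcm p] .
  moreover have "mor_le \<X> p (c ?B q)"
  proof -
    have "f \<in> hom_set \<X> ?A ?B" using f by (simp add: hom_set_def)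
    then show ?thesis using c A B mA p q unfolding closure_operator_def by blast
  qed
  moreover have "mor_le \<X> (c ?B q) (c ?B n)"
  proof -
    have "mor_le \<X> q n" using quasi_right_part_least[OF M fm(1) q n le] .
    moreover have "q \<in> over \<X> \<M> ?B" using q fm by (simp add: quasi_right_part_def)
    moreover have "n \<in> over \<X> \<M> ?B" using n le fm by (simp add: over_def mor_le_def)
    ultimately show ?thesis using c B unfolding closure_operator_def by blast
  qed
  ultimately show ?thesis by (blast intro: mor_le_trans)
qed

text \<open>
  A member of \<open>\<M>\<close> is a quasi right part of itself, and everything lies below the identity;
  so for members of \<open>\<M>\<close> density is a single inequality.
\<close>

lemma quasi_dense_member_iff:
  assumes M: "\<M> \<subseteq> Mor \<X>" and fact: "has_quasi_right_factorizations \<X> \<M>"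
    and c: "closure_operator \<X> \<M> c" and e: "e \<in> \<M>"
  shows "quasi_dense \<X> \<M> c e \<longleftrightarrow> mor_le \<X> (Ident \<X> (Cod \<X> e)) (c (Cod \<X> e) e)"
proof -
  let ?E = "Cod \<X> e"
  have eM: "e \<in> Mor \<X>" using M e by auto
  then have E: "?E \<in> Ob \<X>" and D: "Dom \<X> e \<in> Ob \<X>" by (simp_all add: cod_closed dom_closed)
  have eo: "e \<in> over \<X> \<M> ?E" using e by (simp add: over_def)
  have "\<exists>g \<in> hom_set \<X> (Dom \<X> e) (Dom \<X> e). e = e \<cdot> g"
    using mor_le_refl mor_le_iff[OF eM eM] by blast
  then have qrp: "quasi_right_part \<X> \<M> e e"
    using eo by (simp add: quasi_right_part_def)
  have "c ?E e \<in> over \<X> \<M> ?E" using c E eo unfolding closure_operator_def by blast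
  then have "mor_le \<X> (c ?E e) (Ident \<X> ?E)"
    using M mor_le_Ident[of "c ?E e"] by (auto simp: over_def)
  then have "quasi_dense_in \<X> \<M> c e \<longleftrightarrow> mor_le \<X> (Ident \<X> ?E) (c ?E e)"
    using e by (simp add: quasi_dense_in_def mor_sim_def)
  moreover have "quasi_dense \<X> \<M> c e \<longleftrightarrow> quasi_dense_in \<X> \<M> c e"
    using quasi_dense_iff_all[OF M fact c eM] qrp eM unfolding quasi_dense_def by blast
  ultimately show ?thesis by simp
qed

text \<open>
  Continuity along \<open>q\<close> gives \<open>q \<cdot> c(e) \<le> c(q \<cdot> e)\<close>; as \<open>1 \<le> c(e)\<close>, the left side lies above
  \<open>q\<close>, and \<open>q\<close> lies above the identity because it splits.
\<close>

lemma split_epi_comp_dense: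
  assumes M: "\<M> \<subseteq> Mor \<X>" and fact: "has_quasi_right_factorizations \<X> \<M>"
    and c: "closure_operator \<X> \<M> c"
    and e: "e \<in> \<M>" "quasi_dense \<X> \<M> c e"
    and q: "q \<in> Mor \<X>" "Dom \<X> q = Cod \<X> e"
    and r: "r \<in> Mor \<X>" "Cod \<X> r = Dom \<X> q" "q \<cdot> r = Ident \<X> (Cod \<X> q)"
    and qe: "q \<cdot> e \<in> \<M>"
  shows "quasi_dense \<X> \<M> c (q \<cdot> e)"
proof -
  let ?E = "Cod \<X> e"
  have eM: "e \<in> Mor \<X>" using M e by auto
  then have E: "?E \<in> Ob \<X>" by (rule cod_closed)
  have "c ?E e \<in> over \<X> \<M> ?E"
    using c E e unfolding closure_operator_def over_def by blast
  then have ce: "c ?E e \<in> Mor \<X>" "Cod \<X> (c ?E e) = ?E" using M by (auto simp: over_def)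
  have "mor_le \<X> (Ident \<X> (Cod \<X> q)) q"
    using comp_mor_le[OF q(1) r(1)] r by simp
  moreover have "mor_le \<X> q (q \<cdot> c ?E e)"
  proof -
    have "mor_le \<X> (Ident \<X> ?E) (c ?E e)"
      using e quasi_dense_member_iff[OF M fact c e(1)] by simp
    then have "mor_le \<X> (q \<cdot> Ident \<X> ?E) (q \<cdot> c ?E e)"
      using q ce E by (intro mor_le_postcompose) (simp_all add: ident_closed)
    then show ?thesis using comp_ident_right[OF q(1)] q(2) by simp
  qed
  moreover have "mor_le \<X> (q \<cdot> c ?E e) (c (Cod \<X> q) (q \<cdot> e))"
    using closure_continuous[OF M fact c q(1) e(1) _ qe mor_le_refl] q(2) by simp
  ultimately have "mor_le \<X> (Ident \<X> (Cod \<X> q)) (c (Cod \<X> q) (q \<cdot> e))"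
    by (blast intro: mor_le_trans)
  then show ?thesis
    using quasi_dense_member_iff[OF M fact c qe] q eM by (simp add: cod_comp)
qed

section \<open>The closure as the closed part of a dense-closed factorization\<close>

text \<open>
  The upper bound is monotonicity together with \<open>c(b) \<le> b\<close>. For the lower bound, \<open>e\<close> in \<open>\<M>\<close> is essential: density then
  reads \<open>1 \<le> c(e)\<close>, and continuity along \<open>b\<close> ends at \<open>c(b \<cdot> e)\<close> itself. For a general dense
  \<open>e\<close> the argument would stop at the closure of the quasi right part of \<open>b \<cdot> m\<^bsub>e\<^esub>\<close>.
\<close>

lemma closed_part_sim_closure:
  assumes M: "\<M> \<subseteq> Mor \<X>" and fact: "has_quasi_right_factorizations \<X> \<M>"
    and c: "closure_operator \<X> \<M> c"
    and e: "e \<in> \<M>" "quasi_dense \<X> \<M> c e"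
    and b: "quasi_closed \<X> \<M> c b" "Dom \<X> b = Cod \<X> e"
    and be: "b \<cdot> e \<in> \<M>"
  shows "mor_sim \<X> (c (Cod \<X> b) (b \<cdot> e)) b"
proof -
  let ?A = "Cod \<X> b" and ?E = "Cod \<X> e"
  have bM: "b \<in> \<M>" and bcl: "mor_le \<X> (c ?A b) b"
    using b by (simp_all add: quasi_closed_def mor_sim_def)
  have eX: "e \<in> Mor \<X>" and bX: "b \<in> Mor \<X>" using e bM M by auto
  have A: "?A \<in> Ob \<X>" and E: "?E \<in> Ob \<X>" using eX bX by (simp_all add: cod_closed)
  have "mor_le \<X> (c ?A (b \<cdot> e)) (c ?A b)"
  proof -
    have "mor_le \<X> (b \<cdot> e) b" using comp_mor_le[OF bX eX b(2)] .
    moreover have "b \<cdot> e \<in> over \<X> \<M> ?A" "b \<in> over \<X> \<M> ?A"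
      using be bM bX eX b(2) by (simp_all add: over_def cod_comp)
    ultimately show ?thesis using c A unfolding closure_operator_def by blast
  qed
  then have "mor_le \<X> (c ?A (b \<cdot> e)) b" using bcl by (rule mor_le_trans)
  moreover have "mor_le \<X> b (c ?A (b \<cdot> e))"
  proof -
    have "c ?E e \<in> over \<X> \<M> ?E"
      using c E e unfolding closure_operator_def over_def by blast
    then have ce: "c ?E e \<in> Mor \<X>" "Cod \<X> (c ?E e) = ?E" using M by (auto simp: over_def)
    have "mor_le \<X> (Ident \<X> ?E) (c ?E e)"
      using e quasi_dense_member_iff[OF M fact c e(1)] by simp
    then have "mor_le \<X> (b \<cdot> Ident \<X> ?E) (b \<cdot> c ?E e)"
      using bX b ce E by (intro mor_le_postcompose) (simp_all add: ident_closed)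
    then have "mor_le \<X> b (b \<cdot> c ?E e)" using comp_ident_right[OF bX] b(2) by simp
    moreover have "mor_le \<X> (b \<cdot> c ?E e) (c ?A (b \<cdot> e))"
      using closure_continuous[OF M fact c bX e(1) _ be mor_le_refl] b(2) by simp
    ultimately show ?thesis by (rule mor_le_trans)
  qed
  ultimately show ?thesis by (simp add: mor_sim_def)
qed

lemma dense_closed_factorization:
  assumes M: "\<M> \<subseteq> Mor \<X>" and cod: "is_codomain \<X> \<M>"
    and fs: "quasi_factorization_structure \<X> (dense_class \<X> \<M> c) (closed_class \<X> \<M> c)"
    and m: "m \<in> \<M>"
  obtains e b where "e \<in> \<M>" "quasi_dense \<X> \<M> c e" "quasi_closed \<X> \<M> c b"
    "Dom \<X> b = Cod \<X> e" "m = b \<cdot> e"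
proof -
  obtain e b where eb: "e \<in> dense_class \<X> \<M> c" "b \<in> closed_class \<X> \<M> c"
    "Dom \<X> b = Cod \<X> e" "m = b \<cdot> e"
    using fs m M unfolding quasi_factorization_structure_def by blast
  moreover have "e \<in> \<M>"
    using codomain_right_factor[OF cod, of b e] eb m M
    by (auto simp: dense_class_def closed_class_def)
  ultimately show ?thesis using that by (auto simp: dense_class_def closed_class_def)
qed

lemma quasi_idempotent_if_factorization_structure:
  assumes M: "\<M> \<subseteq> Mor \<X>" and fact: "has_quasi_right_factorizations \<X> \<M>"
    and cod: "is_codomain \<X> \<M>" and c: "closure_operator \<X> \<M> c"
    and fs: "quasi_factorization_structure \<X> (dense_class \<X> \<M> c) (closed_class \<X> \<M> c)"
  shows "quasi_idempotent \<X> \<M> c"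
  unfolding quasi_idempotent_def
proof (intro ballI)
  fix A m assume A: "A \<in> Ob \<X>" and m: "m \<in> over \<X> \<M> A"
  then have mM: "m \<in> \<M>" "Cod \<X> m = A" by (simp_all add: over_def)
  obtain e b where e: "e \<in> \<M>" "quasi_dense \<X> \<M> c e" and b: "quasi_closed \<X> \<M> c b"
    "Dom \<X> b = Cod \<X> e" "m = b \<cdot> e"
    using dense_closed_factorization[OF M cod fs mM(1)] .
  have bM: "b \<in> \<M>" using b by (simp add: quasi_closed_def)
  then have "b \<in> Mor \<X>" "e \<in> Mor \<X>" using e M by auto
  then have bA: "Cod \<X> b = A" using mM b by (auto simp: cod_comp)
  have sim: "mor_sim \<X> (c A m) b"
    using closed_part_sim_closure[OF M fact c e b(1,2)] b(3) mM bA by simp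
  have "c A m \<in> over \<X> \<M> A" using c A m unfolding closure_operator_def by blast
  moreover have "b \<in> over \<X> \<M> A" using bM bA by (simp add: over_def)
  ultimately have "mor_sim \<X> (c A (c A m)) (c A b)"
    using sim c A unfolding closure_operator_def mor_sim_def by blast
  moreover have "mor_sim \<X> (c A b) b" using b bA by (simp add: quasi_closed_def)
  moreover have "mor_sim \<X> b (c A m)" using sim by (simp add: mor_sim_def)
  ultimately show "mor_sim \<X> (c A (c A m)) (c A m)" by (blast intro: mor_sim_trans)
qed

text \<open>
  The equivalence of \<open>b\<close> and \<open>c(m)\<close> provides a comparison \<open>q\<close> from the domain of \<open>b\<close> to that of
  \<open>c(m)\<close>. It may fail to be unique, but any choice is split by strong quasi monicity of
  \<open>c(m)\<close>, and \<open>q \<cdot> e\<close> is the dense morphism sought.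
\<close>

lemma quasi_weakly_hereditary_if_factorization_structure:
  assumes M: "\<M> \<subseteq> Mor \<X>" and fact: "has_quasi_right_factorizations \<X> \<M>"
    and mono: "\<forall>m\<in>\<M>. strongly_quasi_mono \<X> m"
    and cod: "is_codomain \<X> \<M>" and c: "closure_operator \<X> \<M> c"
    and fs: "quasi_factorization_structure \<X> (dense_class \<X> \<M> c) (closed_class \<X> \<M> c)"
  shows "quasi_weakly_hereditary \<X> \<M> c"
  unfolding quasi_weakly_hereditary_def
proof (intro ballI)
  fix A m assume A: "A \<in> Ob \<X>" and m: "m \<in> over \<X> \<M> A"
  then have mM: "m \<in> \<M>" "Cod \<X> m = A" by (simp_all add: over_def)
  obtain e b where e: "e \<in> \<M>" "quasi_dense \<X> \<M> c e" and b: "quasi_closed \<X> \<M> c b"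
    "Dom \<X> b = Cod \<X> e" "m = b \<cdot> e"
    using dense_closed_factorization[OF M cod fs mM(1)] .
  have bX: "b \<in> Mor \<X>" using b M by (auto simp: quasi_closed_def)
  have eX: "e \<in> Mor \<X>" using e M by auto
  have bA: "Cod \<X> b = A" using mM b bX eX by (auto simp: cod_comp)
  let ?cm = "c A m"
  have sim: "mor_sim \<X> ?cm b"
    using closed_part_sim_closure[OF M fact c e b(1,2)] b(3) mM bA by simp
  have "?cm \<in> over \<X> \<M> A" using c A m unfolding closure_operator_def by blast
  then have cmM: "?cm \<in> \<M>" and cmX: "?cm \<in> Mor \<X>" using M by (auto simp: over_def)
  have le: "mor_le \<X> ?cm b" "mor_le \<X> b ?cm" using sim by (simp_all add: mor_sim_def)
  obtain p where p: "p \<in> Mor \<X>" "Dom \<X> p = Dom \<X> ?cm" "Cod \<X> p = Dom \<X> b" "?cm = b \<cdot> p"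
    using le(1) unfolding mor_le_iff[OF cmX bX] hom_set_def by blast
  obtain q where q: "q \<in> Mor \<X>" "Dom \<X> q = Dom \<X> b" "Cod \<X> q = Dom \<X> ?cm" "b = ?cm \<cdot> q"
    using le(2) unfolding mor_le_iff[OF bX cmX] hom_set_def by blast
  have "?cm \<cdot> (q \<cdot> p) = (?cm \<cdot> q) \<cdot> p"
    using cmX q(1-3) p(1-3) by (simp add: comp_assoc)
  also have "\<dots> = ?cm" by (simp only: p(4)[symmetric] q(4)[symmetric])
  finally have "?cm \<cdot> (q \<cdot> p) = ?cm" .
  moreover have "q \<cdot> p \<in> hom_set \<X> (Dom \<X> ?cm) (Dom \<X> ?cm)"
    using q(1-3) p(1-3) by (simp add: hom_set_def comp_closed dom_comp cod_comp)
  ultimately obtain s where s: "s \<in> Mor \<X>" "Cod \<X> s = Dom \<X> ?cm"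
    "(q \<cdot> p) \<cdot> s = Ident \<X> (Dom \<X> ?cm)"
    using strongly_quasi_mono_stabilizer_split[of ?cm "q \<cdot> p"] mono cmM
    by (auto simp: hom_set_def)
  have split: "p \<cdot> s \<in> Mor \<X>" "Cod \<X> (p \<cdot> s) = Dom \<X> q"
      "q \<cdot> (p \<cdot> s) = Ident \<X> (Cod \<X> q)"
    using p(1-3) q(1-3) s comp_assoc[of q p s] by (simp_all add: comp_closed cod_comp)
  have qe: "Dom \<X> q = Cod \<X> e" using q(2) b(2) by simp
  have qeX: "q \<cdot> e \<in> Mor \<X>" "Dom \<X> (q \<cdot> e) = Dom \<X> e" "Cod \<X> (q \<cdot> e) = Dom \<X> ?cm"
    using q(1,3) eX qe by (simp_all add: comp_closed dom_comp cod_comp)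
  have "?cm \<cdot> (q \<cdot> e) = (?cm \<cdot> q) \<cdot> e"
    using cmX q(1,3) eX qe by (simp add: comp_assoc)
  also have "\<dots> = m" by (simp only: b(3)[symmetric] q(4)[symmetric])
  finally have comp: "?cm \<cdot> (q \<cdot> e) = m" .
  have "q \<cdot> e \<in> \<M>"
    using codomain_right_factor[OF cod cmX qeX(1)] qeX comp mM by simp
  then have "quasi_dense \<X> \<M> c (q \<cdot> e)"
    using split_epi_comp_dense[OF M fact c e q(1) qe split] by simp
  moreover have "Dom \<X> m = Dom \<X> e" using b bX eX by (simp add: dom_comp)
  ultimately show "\<exists>j \<in> hom_set \<X> (Dom \<X> m) (Dom \<X> ?cm). quasi_dense \<X> \<M> c j \<and> ?cm \<cdot> j = m"
    using comp qeX by (auto simp: hom_set_def)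
qed

end

theorem theorem5p18:
  fixes \<X> :: "('o, 'm) cat"
    and \<M> :: "'m set"
    and c :: "'o \<Rightarrow> 'm \<Rightarrow> 'm"
  assumes "category \<X>"
    and "\<M> \<subseteq> Mor \<X>"
    and "has_quasi_right_factorizations \<X> \<M>"
    and "\<forall>m\<in>\<M>. strongly_quasi_mono \<X> m"
    and "is_codomain \<X> \<M>"
    and "closure_operator \<X> \<M> c"
    and "quasi_factorization_structure \<X> (dense_class \<X> \<M> c) (closed_class \<X> \<M> c)"
  shows "quasi_weakly_hereditary \<X> \<M> c \<and> quasi_idempotent \<X> \<M> c"
  using assms category.quasi_weakly_hereditary_if_factorization_structure
    category.quasi_idempotent_if_factorization_structure by blast

end
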